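(* Suppose $(S,\to,\twoheadrightarrow,\hookrightarrow)$ is a finite two-acyclic factorization system. The map $x\mapsto(T(x),T(x)^\perp)$ is an isomorphism from the transitive closure of $\rightsquigarrow$ on $S$ to the forcing preorder on $\operatorname{Ji}(\operatorname{Pairs}(\to))$. This map induces an isomorphism from the poset of $\rightsquigarrow$-downsets under containment to the congruence lattice $\operatorname{Con}(\operatorname{Pairs}(\to))$.
   Context: For a binary relation $\to$ on a set $S$ and $X\subseteq S$, put $X^\perp=\{y\in S: x\not\to y\ \forall x\in X\}$ and ${}^\perp X=\{y\in S: y\not\to x\ \forall x\in X\}$. A maximal orthogonal pair is a pair $(X,Y)$ of subsets of $S$ with $Y=X^\perp$ and $X={}^\perp Y$. $\operatorname{Pairs}(\to)$ is the complete lattice of maximal orthogonal pairs, partially ordered by containment of first components (equivalently reverse containment of second components). For a reflexive relation $\to$ on $S$, $\operatorname{Fact}(\to)=(\twoheadrightarrow,\hookrightarrow)$, where $x\twoheadrightarrow y$ iff for all $z$, $y\to z$ implies $x\to z$, and $x\hookrightarrow y$ iff for all $z$, $z\to x$ implies $z\to y$. For preorders $\twoheadrightarrow,\hookrightarrow$ on $S$, $\operatorname{Mult}(\twoheadrightarrow,\hookrightarrow)$ is the relation relating $x$ to $z$ iff there is $y\in S$ with $x\twoheadrightarrow y\hookrightarrow z$. A factorization system is a tuple $(S,\to,\twoheadrightarrow,\hookrightarrow)$ with $\to$ a reflexive relation on $S$, $\operatorname{Fact}(\to)=(\twoheadrightarrow,\hookrightarrow)$ and $\operatorname{Mult}(\twoheadrightarrow,\hookrightarrow)=\to$.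 It is finite if $S$ is finite. It is two-acyclic if it satisfies the order condition ($x\twoheadrightarrow y\twoheadrightarrow x$ implies $x=y$, and $x\hookrightarrow y\hookrightarrow x$ implies $x=y$) and the brick condition ($x\twoheadrightarrow y\hookrightarrow x$ implies $x=y$). Convention: $x\twoheadrightarrow y$ or $x\hookrightarrow y$ is read as "$x$ is greater than or equal to $y$"; thus $x$ is $\twoheadrightarrow$-minimal in $A\ni x$ if there is no $x'\in A\setminus\{x\}$ with $x\twoheadrightarrow x'$, and $\hookrightarrow$-maximal in $A$ if there is no $x'\in A\setminus\{x\}$ with $x'\hookrightarrow x$. For $y\in S$, $T(y)=\{x'\in S: y\twoheadrightarrow x'\}$ and $F(y)=\{x'\in S: x'\hookrightarrow y\}$. The relation $\rightsquigarrow$ on $S$: $x\rightsquigarrow y$ iff either $x$ is $\twoheadrightarrow$-minimal in $F(y)$ or $x$ is $\hookrightarrow$-maximal in $T(y)$. A $\rightsquigarrow$-downset is a subset $D\subseteq S$ such that $x\in D$ and $x\rightsquigarrow y$ imply $y\in D$. For a finite lattice $L$, $\operatorname{Ji}L$ is the set of join-irreducible elements (those covering exactly one element, denoted $j_*$), and $\operatorname{Con}(L)$ is the lattice of lattice congruences of $L$ ordered by refinement (finer is smaller). The forcing preorder on $\operatorname{Ji}L$: $j$ forces $j'$ iff every congruence $\Theta$ with $j_*\equiv j\bmod\Theta$ also has $j'_*\equiv j'\bmod\Theta$. The isomorphism in the first assertion is a bijection such that $x$ is related to $y$ by the transitive closure of $\rightsquigarrow$ iff $(T(x),T(x)^\perp)$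 forces $(T(y),T(y)^\perp)$. The induced map in the second assertion takes a $\rightsquigarrow$-downset $D$ to the congruence $\Theta$ for which $D$ is exactly the set of $x\in S$ such that $j_*\equiv j\bmod\Theta$ where $j=(T(x),T(x)^\perp)$. *)

theory Defs
  imports "HOL-Algebra.Complete_Lattice"
begin

text \<open>
  A binary relation on a set \<open>S\<close> is a set of pairs \<open>r \<subseteq> S \<times> S\<close>. The letters \<open>arrow\<close>, \<open>onto\<close> and
  \<open>into\<close> stand for \<open>\<rightarrow>\<close>, \<open>\<twoheadrightarrow>\<close> and \<open>\<hookrightarrow>\<close>. Following the convention that \<open>x \<twoheadrightarrow> y\<close> and \<open>x \<hookrightarrow> y\<close>
  mean that \<open>x\<close> is greater than or equal to \<open>y\<close>, the first component of a pair in \<open>onto\<close> or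
  \<open>into\<close> is the larger one.
\<close>

section \<open>Maximal orthogonal pairs\<close>

definition right_perp :: "'a set \<Rightarrow> 'a rel \<Rightarrow> 'a set \<Rightarrow> 'a set" where
  "right_perp S arrow X = {y \<in> S. \<forall>x\<in>X. (x, y) \<notin> arrow}"

definition left_perp :: "'a set \<Rightarrow> 'a rel \<Rightarrow> 'a set \<Rightarrow> 'a set" where
  "left_perp S arrow X = {y \<in> S. \<forall>x\<in>X. (y, x) \<notin> arrow}"

definition Pairs :: "'a set \<Rightarrow> 'a rel \<Rightarrow> ('a set \<times> 'a set) gorder" where
  "Pairs S arrow =
    \<lparr>carrier = {(X, Y). X \<subseteq> S \<and> Y \<subseteq> S \<and> Y = right_perp S arrow X \<and> X = left_perp S arrow Y},
     eq = (=),
     le = (\<lambda>p q. fst p \<subseteq> fst q)\<rparr>"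

lemma Pairs_complete_lattice: "complete_lattice (Pairs S arrow)"
proof -
  let ?L = "Pairs S arrow"
  let ?r = "right_perp S arrow" and ?l = "left_perp S arrow"
  have car: "p \<in> carrier ?L \<longleftrightarrow> snd p = ?r (fst p) \<and> fst p = ?l (snd p)" for p
    by (cases p) (auto simp: Pairs_def right_perp_def left_perp_def)
  have le: "p \<sqsubseteq>\<^bsub>?L\<^esub> q \<longleftrightarrow> fst p \<subseteq> fst q" and eq: "p .=\<^bsub>?L\<^esub> q \<longleftrightarrow> p = q" for p q
    by (simp_all add: Pairs_def)
  have anti: "?l B \<subseteq> ?l A" "?r B \<subseteq> ?r A" if "A \<subseteq> B" for A B
    using that by (auto simp: right_perp_def left_perp_def)
  have sub: "?l A \<subseteq> S" "?r A \<subseteq> S" for A by (auto simp: right_perp_def left_perp_def)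
  have ext: "A \<subseteq> ?l (?r A)" "A \<subseteq> ?r (?l A)" if "A \<subseteq> S" for A
    using that by (auto simp: right_perp_def left_perp_def)
  have rlr: "?r (?l (?r A)) = ?r A" if "A \<subseteq> S" for A
    using anti(2)[OF ext(1)[OF that]] ext(2)[OF sub(2)] by blast
  have lrl: "?l (?r (?l A)) = ?l A" if "A \<subseteq> S" for A
    using anti(1)[OF ext(2)[OF that]] ext(1)[OF sub(1)] by blast
  have le2: "fst p \<subseteq> fst q \<longleftrightarrow> snd q \<subseteq> snd p" if "p \<in> carrier ?L" "q \<in> carrier ?L" for p q
    using that anti unfolding car by metis
  have subS: "fst p \<subseteq> S" "snd p \<subseteq> S" if "p \<in> carrier ?L" for p
    using that sub unfolding car by metis+
  show ?thesis
  proof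
    fix p q assume "p \<sqsubseteq>\<^bsub>?L\<^esub> q" "q \<sqsubseteq>\<^bsub>?L\<^esub> p" "p \<in> carrier ?L" "q \<in> carrier ?L"
    then show "p .=\<^bsub>?L\<^esub> q"
      unfolding le eq car by (metis prod.expand subset_antisym)
  next
    fix A assume A: "A \<subseteq> carrier ?L"
    define U where "U = (\<Union>p\<in>A. fst p)"
    have U: "U \<subseteq> S" unfolding U_def using A subS(1) by blast
    have c: "(?l (?r U), ?r U) \<in> carrier ?L" using rlr[OF U] by (simp add: car)
    have "least ?L (?l (?r U), ?r U) (Upper ?L A)"
    proof (rule least_UpperI)
      fix p assume "p \<in> A"
      then have "fst p \<subseteq> U" by (auto simp: U_def)
      then show "p \<sqsubseteq>\<^bsub>?L\<^esub> (?l (?r U), ?r U)" using ext(1)[OF U] by (auto simp: le)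
    next
      fix q assume q: "q \<in> Upper ?L A"
      then have qc: "q \<in> carrier ?L" by (simp add: Upper_def)
      have "U \<subseteq> fst q" using q A by (fastforce simp: Upper_def le U_def)
      then have "?l (?r U) \<subseteq> ?l (?r (fst q))" using anti by blast
      also have "\<dots> = fst q" using qc by (metis car)
      finally show "(?l (?r U), ?r U) \<sqsubseteq>\<^bsub>?L\<^esub> q" by (simp add: le)
    qed (use A c in auto)
    then show "\<exists>s. least ?L s (Upper ?L A)" by blast
    define V where "V = (\<Union>p\<in>A. snd p)"
    have V: "V \<subseteq> S" unfolding V_def using A subS(2) by blast
    have d: "(?l V, ?r (?l V)) \<in> carrier ?L" using lrl[OF V] by (simp add: car)
    have "greatest ?L (?l V, ?r (?l V)) (Lower ?L A)"
    proof (rule greatest_LowerI)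
      fix p assume p: "p \<in> A"
      then have "snd p \<subseteq> V" by (auto simp: V_def)
      then have "?l V \<subseteq> ?l (snd p)" using anti by blast
      also have "\<dots> = fst p" using p A by (metis car subsetD)
      finally show "(?l V, ?r (?l V)) \<sqsubseteq>\<^bsub>?L\<^esub> p" by (simp add: le)
    next
      fix q assume q: "q \<in> Lower ?L A"
      then have qc: "q \<in> carrier ?L" by (simp add: Lower_def)
      have "snd p \<subseteq> snd q" if "p \<in> A" for p
      proof -
        have "fst q \<subseteq> fst p" "p \<in> carrier ?L" using q that A unfolding Lower_def le by blast+
        then show ?thesis using le2[OF qc] by blast
      qed
      then have "V \<subseteq> snd q" by (auto simp: V_def)
      then have "?l (snd q) \<subseteq> ?l V" using anti by blast
      then show "q \<sqsubseteq>\<^bsub>?L\<^esub> (?l V, ?r (?l V))" using qc by (metis car fst_conv le)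
    qed (use A d in auto)
    then show "\<exists>i. greatest ?L i (Lower ?L A)" by blast
  qed (auto simp: le eq fun_eq_iff)
qed

section \<open>Two-acyclic factorization systems\<close>

definition Fact :: "'a set \<Rightarrow> 'a rel \<Rightarrow> 'a rel \<times> 'a rel" where
  "Fact S arrow =
    ({(x, y) \<in> S \<times> S. \<forall>z\<in>S. (y, z) \<in> arrow \<longrightarrow> (x, z) \<in> arrow},
     {(x, y) \<in> S \<times> S. \<forall>z\<in>S. (z, x) \<in> arrow \<longrightarrow> (z, y) \<in> arrow})"

definition Mult :: "'a set \<Rightarrow> 'a rel \<Rightarrow> 'a rel \<Rightarrow> 'a rel" where
  "Mult S onto into = {(x, z) \<in> S \<times> S. \<exists>y\<in>S. (x, y) \<in> onto \<and> (y, z) \<in> into}"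

definition factorization_system :: "'a set \<Rightarrow> 'a rel \<Rightarrow> 'a rel \<Rightarrow> 'a rel \<Rightarrow> bool" where
  "factorization_system S arrow onto into \<longleftrightarrow>
    arrow \<subseteq> S \<times> S \<and> refl_on S arrow \<and>
    Fact S arrow = (onto, into) \<and> Mult S onto into = arrow"

definition order_condition :: "'a rel \<Rightarrow> 'a rel \<Rightarrow> bool" where
  "order_condition onto into \<longleftrightarrow> antisym onto \<and> antisym into"

definition brick_condition :: "'a rel \<Rightarrow> 'a rel \<Rightarrow> bool" where
  "brick_condition onto into \<longleftrightarrow> (\<forall>x y. (x, y) \<in> onto \<and> (y, x) \<in> into \<longrightarrow> x = y)"

definition two_acyclic_factorization_system ::
    "'a set \<Rightarrow> 'a rel \<Rightarrow> 'a rel \<Rightarrow> 'a rel \<Rightarrow> bool" where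
  "two_acyclic_factorization_system S arrow onto into \<longleftrightarrow>
    factorization_system S arrow onto into \<and>
    order_condition onto into \<and> brick_condition onto into"

section \<open>The relation \<open>\<leadsto>\<close>\<close>

definition T_set :: "'a set \<Rightarrow> 'a rel \<Rightarrow> 'a \<Rightarrow> 'a set" where
  "T_set S onto y = {x \<in> S. (y, x) \<in> onto}"

definition F_set :: "'a set \<Rightarrow> 'a rel \<Rightarrow> 'a \<Rightarrow> 'a set" where
  "F_set S into y = {x \<in> S. (x, y) \<in> into}"

definition minimal_in :: "'a rel \<Rightarrow> 'a set \<Rightarrow> 'a \<Rightarrow> bool" where
  "minimal_in r A x \<longleftrightarrow> x \<in> A \<and> \<not> (\<exists>x'\<in>A - {x}. (x, x') \<in> r)"

definition maximal_in :: "'a rel \<Rightarrow> 'a set \<Rightarrow> 'a \<Rightarrow> bool" where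
  "maximal_in r A x \<longleftrightarrow> x \<in> A \<and> \<not> (\<exists>x'\<in>A - {x}. (x', x) \<in> r)"

definition squig :: "'a set \<Rightarrow> 'a rel \<Rightarrow> 'a rel \<Rightarrow> 'a rel" where
  "squig S onto into =
    {(x, y) \<in> S \<times> S. minimal_in onto (F_set S into y) x \<or> maximal_in into (T_set S onto y) x}"

definition squig_downsets :: "'a set \<Rightarrow> 'a rel \<Rightarrow> 'a rel \<Rightarrow> 'a set gorder" where
  "squig_downsets S onto into =
    \<lparr>carrier = {D. D \<subseteq> S \<and> (\<forall>x y. x \<in> D \<and> (x, y) \<in> squig S onto into \<longrightarrow> y \<in> D)},
     eq = (=), le = (\<subseteq>)\<rparr>"

section \<open>Join-irreducible elements, congruences and forcing\<close>

definition covers :: "('a, 'b) gorder_scheme \<Rightarrow> 'a \<Rightarrow> 'a \<Rightarrow> bool" where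
  "covers L x y \<longleftrightarrow> x \<in> carrier L \<and> y \<in> carrier L \<and> y \<sqsubset>\<^bsub>L\<^esub> x \<and>
    \<not> (\<exists>z\<in>carrier L. y \<sqsubset>\<^bsub>L\<^esub> z \<and> z \<sqsubset>\<^bsub>L\<^esub> x)"

definition Ji :: "('a, 'b) gorder_scheme \<Rightarrow> 'a set" where
  "Ji L = {j \<in> carrier L. \<exists>!x. covers L j x}"

text \<open>The element \<open>j\<^sub>*\<close>; meaningful only for \<open>j \<in> Ji L\<close>.\<close>

definition lower_cover :: "('a, 'b) gorder_scheme \<Rightarrow> 'a \<Rightarrow> 'a" where
  "lower_cover L j = (THE x. covers L j x)"

definition lattice_congruence :: "('a, 'b) gorder_scheme \<Rightarrow> 'a rel \<Rightarrow> bool" where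
  "lattice_congruence L \<Theta> \<longleftrightarrow> equiv (carrier L) \<Theta> \<and>
    (\<forall>x x' y y'. (x, x') \<in> \<Theta> \<and> (y, y') \<in> \<Theta> \<longrightarrow>
      (x \<squnion>\<^bsub>L\<^esub> y, x' \<squnion>\<^bsub>L\<^esub> y') \<in> \<Theta> \<and> (x \<sqinter>\<^bsub>L\<^esub> y, x' \<sqinter>\<^bsub>L\<^esub> y') \<in> \<Theta>)"

definition Con :: "('a, 'b) gorder_scheme \<Rightarrow> 'a rel gorder" where
  "Con L = \<lparr>carrier = {\<Theta>. lattice_congruence L \<Theta>}, eq = (=), le = (\<subseteq>)\<rparr>"

definition contracts :: "('a, 'b) gorder_scheme \<Rightarrow> 'a rel \<Rightarrow> 'a \<Rightarrow> bool" where
  "contracts L \<Theta> j \<longleftrightarrow> (lower_cover L j, j) \<in> \<Theta>"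

definition forces :: "('a, 'b) gorder_scheme \<Rightarrow> 'a \<Rightarrow> 'a \<Rightarrow> bool" where
  "forces L j j' \<longleftrightarrow> (\<forall>\<Theta>\<in>carrier (Con L). contracts L \<Theta> j \<longrightarrow> contracts L \<Theta> j')"

section \<open>The two maps\<close>

definition relation_iso ::
    "'a set \<Rightarrow> ('a \<Rightarrow> 'a \<Rightarrow> bool) \<Rightarrow> 'b set \<Rightarrow> ('b \<Rightarrow> 'b \<Rightarrow> bool) \<Rightarrow> ('a \<Rightarrow> 'b) \<Rightarrow> bool" where
  "relation_iso A r B s f \<longleftrightarrow>
    bij_betw f A B \<and> (\<forall>x\<in>A. \<forall>y\<in>A. r x y \<longleftrightarrow> s (f x) (f y))"

definition poset_iso ::
    "('a, 'c) gorder_scheme \<Rightarrow> ('b, 'd) gorder_scheme \<Rightarrow> ('a \<Rightarrow> 'b) \<Rightarrow> bool" where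
  "poset_iso P Q f \<longleftrightarrow> relation_iso (carrier P) (le P) (carrier Q) (le Q) f"

definition T_pair :: "'a set \<Rightarrow> 'a rel \<Rightarrow> 'a rel \<Rightarrow> 'a \<Rightarrow> 'a set \<times> 'a set" where
  "T_pair S arrow onto x = (T_set S onto x, right_perp S arrow (T_set S onto x))"

definition is_induced_congruence ::
    "'a set \<Rightarrow> 'a rel \<Rightarrow> 'a rel \<Rightarrow> 'a set \<Rightarrow> ('a set \<times> 'a set) rel \<Rightarrow> bool" where
  "is_induced_congruence S arrow onto D \<Theta> \<longleftrightarrow>
    \<Theta> \<in> carrier (Con (Pairs S arrow)) \<and>
    D = {x \<in> S. contracts (Pairs S arrow) \<Theta> (T_pair S arrow onto x)}"

definition induced_congruence ::
    "'a set \<Rightarrow> 'a rel \<Rightarrow> 'a rel \<Rightarrow> 'a set \<Rightarrow> ('a set \<times> 'a set) rel" where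
  "induced_congruence S arrow onto D = (THE \<Theta>. is_induced_congruence S arrow onto D \<Theta>)"

end

theory Submission
  imports Defs
begin

text \<open>
  For a \<open>\<leadsto>\<close>-downset \<open>D\<close>, declare two maximal orthogonal pairs equivalent if their first components
  agree outside \<open>D\<close>. This clearly respects meets, which are intersections of first components. It
  respects joins because agreement of first components outside \<open>D\<close> is the same as agreement of
  second components outside \<open>D\<close>: if \<open>Y \<inter> F(z)\<close> is nonempty for a first component \<open>Y\<close>, then it
  contains a \<open>\<twoheadrightarrow>\<close>-minimal element \<open>v\<close> of \<open>F(z)\<close>, so \<open>v \<leadsto> z\<close>, and \<open>z \<notin> D\<close> implies \<open>v \<notin> D\<close>.
  Conversely, the set \<open>D\<close> of elements contracted by a congruence is a \<open>\<leadsto>\<close>-downset, because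
  contracting \<open>(T(x), T(x)\<^sup>\<bottom>)\<close> amounts to collapsing the meet-irreducible pair with second component
  \<open>F(x)\<close> with its upper cover; and the congruence is recovered from \<open>D\<close> since one climbs from \<open>X\<close>
  to a larger \<open>Y\<close> by adding one element of \<open>Y - X\<close> at a time, joining with its \<open>T\<close>.
\<close>

section \<open>The lattice of maximal orthogonal pairs\<close>

lemma perp_antimono:
  "A \<subseteq> B \<Longrightarrow> left_perp S R B \<subseteq> left_perp S R A"
  "A \<subseteq> B \<Longrightarrow> right_perp S R B \<subseteq> right_perp S R A"
  by (auto simp: left_perp_def right_perp_def)

lemma carrier_Pairs_iff:
  "p \<in> carrier (Pairs S R) \<longleftrightarrow>
    snd p = right_perp S R (fst p) \<and> fst p = left_perp S R (snd p)"
  by (cases p) (auto simp: Pairs_def right_perp_def left_perp_def)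

lemma le_Pairs [simp]: "p \<sqsubseteq>\<^bsub>Pairs S R\<^esub> q \<longleftrightarrow> fst p \<subseteq> fst q"
  and eq_Pairs [simp]: "p .=\<^bsub>Pairs S R\<^esub> q \<longleftrightarrow> p = q"
  by (simp_all add: Pairs_def)

lemma Pairs_subset:
  assumes "p \<in> carrier (Pairs S R)"
  shows "fst p \<subseteq> S" "snd p \<subseteq> S"
  using assms by (auto simp: Pairs_def)

lemma Pairs_eqI:
  assumes "p \<in> carrier (Pairs S R)" "q \<in> carrier (Pairs S R)" "fst p = fst q \<or> snd p = snd q"
  shows "p = q"
  using assms unfolding carrier_Pairs_iff by (metis prod.expand)

lemma Pairs_snd_antimono:
  assumes "p \<in> carrier (Pairs S R)" "q \<in> carrier (Pairs S R)"
  shows "fst p \<subseteq> fst q \<longleftrightarrow> snd q \<subseteq> snd p"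
  using assms perp_antimono unfolding carrier_Pairs_iff by metis

lemma Pairs_disjoint:
  assumes "p \<in> carrier (Pairs S R)" "x \<in> fst p" "y \<in> snd p"
  shows "(x, y) \<notin> R"
  using assms by (auto simp: Pairs_def right_perp_def)

lemma Pairs_fstI:
  assumes "p \<in> carrier (Pairs S R)" "x \<in> S" "\<And>y. y \<in> snd p \<Longrightarrow> (x, y) \<notin> R"
  shows "x \<in> fst p"
  using assms by (auto simp: Pairs_def left_perp_def)

lemma Pairs_sndI:
  assumes "p \<in> carrier (Pairs S R)" "y \<in> S" "\<And>x. x \<in> fst p \<Longrightarrow> (x, y) \<notin> R"
  shows "y \<in> snd p"
  using assms by (auto simp: Pairs_def right_perp_def)

lemma join_Pairs_closed:
  assumes "p \<in> carrier (Pairs S R)" "q \<in> carrier (Pairs S R)"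
  shows "p \<squnion>\<^bsub>Pairs S R\<^esub> q \<in> carrier (Pairs S R)"
proof -
  interpret complete_lattice "Pairs S R" by (rule Pairs_complete_lattice)
  show ?thesis using assms by (rule join_closed)
qed

lemma meet_Pairs_closed:
  assumes "p \<in> carrier (Pairs S R)" "q \<in> carrier (Pairs S R)"
  shows "p \<sqinter>\<^bsub>Pairs S R\<^esub> q \<in> carrier (Pairs S R)"
proof -
  interpret complete_lattice "Pairs S R" by (rule Pairs_complete_lattice)
  show ?thesis using assms by (rule meet_closed)
qed

text \<open>An intersection of two left orthogonals is a left orthogonal, so the intersection of
  first components already belongs to a pair.\<close>

lemma fst_meet_Pairs:
  assumes p: "p \<in> carrier (Pairs S R)" and q: "q \<in> carrier (Pairs S R)"
  shows "fst (p \<sqinter>\<^bsub>Pairs S R\<^esub> q) = fst p \<inter> fst q"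
proof -
  interpret complete_lattice "Pairs S R" by (rule Pairs_complete_lattice)
  let ?m = "(fst p \<inter> fst q, right_perp S R (fst p \<inter> fst q))"
  have m: "?m \<in> carrier (Pairs S R)"
    using p q unfolding Pairs_def by (auto simp: left_perp_def right_perp_def)
  have "fst ?m \<subseteq> fst (p \<sqinter>\<^bsub>Pairs S R\<^esub> q)"
    using meet_le[of ?m p q] m p q by simp
  moreover have "fst (p \<sqinter>\<^bsub>Pairs S R\<^esub> q) \<subseteq> fst p" "fst (p \<sqinter>\<^bsub>Pairs S R\<^esub> q) \<subseteq> fst q"
    using meet_left[OF p q] meet_right[OF p q] by simp_all
  ultimately show ?thesis by auto
qed

text \<open>Joins are computed on second components, because the first component of a join is in
  general larger than the union.\<close>

lemma snd_join_Pairs: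
  assumes p: "p \<in> carrier (Pairs S R)" and q: "q \<in> carrier (Pairs S R)"
  shows "snd (p \<squnion>\<^bsub>Pairs S R\<^esub> q) = snd p \<inter> snd q"
proof -
  interpret complete_lattice "Pairs S R" by (rule Pairs_complete_lattice)
  let ?j = "p \<squnion>\<^bsub>Pairs S R\<^esub> q"
  let ?m = "(left_perp S R (snd p \<inter> snd q), snd p \<inter> snd q)"
  have m: "?m \<in> carrier (Pairs S R)"
    unfolding carrier_Pairs_iff
  proof (simp, intro equalityI)
    show "snd p \<inter> snd q \<subseteq> right_perp S R (left_perp S R (snd p \<inter> snd q))"
      using Pairs_subset[OF p] by (auto simp: left_perp_def right_perp_def)
    \<comment> \<open>Double orthogonal is a closure operator that fixes second components; this is
      used with \<open>r\<close> equal to \<open>p\<close> and to \<open>q\<close>.\<close>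
    have "right_perp S R (left_perp S R (snd p \<inter> snd q)) \<subseteq> snd r"
      if "r \<in> carrier (Pairs S R)" "snd p \<inter> snd q \<subseteq> snd r" for r
      using that perp_antimono unfolding carrier_Pairs_iff by metis
    then show "right_perp S R (left_perp S R (snd p \<inter> snd q)) \<subseteq> snd p \<inter> snd q"
      using p q by simp
  qed
  have j: "?j \<in> carrier (Pairs S R)" using p q by (rule join_Pairs_closed)
  have "fst p \<subseteq> fst ?m" "fst q \<subseteq> fst ?m"
    using Pairs_snd_antimono[OF p m] Pairs_snd_antimono[OF q m] by simp_all
  then have "fst ?j \<subseteq> fst ?m"
    using join_le[OF _ _ p q m] by simp
  then have "snd ?m \<subseteq> snd ?j" using Pairs_snd_antimono[OF j m] by simp
  moreover have "fst p \<subseteq> fst ?j" "fst q \<subseteq> fst ?j"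
    using join_left[OF p q] join_right[OF p q] by simp_all
  then have "snd ?j \<subseteq> snd p" "snd ?j \<subseteq> snd q"
    using Pairs_snd_antimono p q j by blast+
  ultimately show ?thesis by auto
qed

lemma meet_Pairs_eqI:
  assumes "p \<in> carrier (Pairs S R)" "q \<in> carrier (Pairs S R)" "r \<in> carrier (Pairs S R)"
    and "fst p \<inter> fst q = fst r"
  shows "p \<sqinter>\<^bsub>Pairs S R\<^esub> q = r"
  using assms by (metis Pairs_eqI fst_meet_Pairs meet_Pairs_closed)

lemma join_Pairs_eqI:
  assumes "p \<in> carrier (Pairs S R)" "q \<in> carrier (Pairs S R)" "r \<in> carrier (Pairs S R)"
    and "snd p \<inter> snd q = snd r"
  shows "p \<squnion>\<^bsub>Pairs S R\<^esub> q = r"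
  using assms by (metis Pairs_eqI snd_join_Pairs join_Pairs_closed)

lemma join_Pairs_absorb:
  assumes "p \<in> carrier (Pairs S R)" "q \<in> carrier (Pairs S R)" "fst p \<subseteq> fst q"
  shows "p \<squnion>\<^bsub>Pairs S R\<^esub> q = q"
  using assms Pairs_snd_antimono[OF assms(1,2)] by (intro join_Pairs_eqI) auto

section \<open>Congruences and minimal elements\<close>

lemma
  assumes "lattice_congruence L \<Theta>"
  shows lattice_congruence_refl: "x \<in> carrier L \<Longrightarrow> (x, x) \<in> \<Theta>"
    and lattice_congruence_sym: "(x, y) \<in> \<Theta> \<Longrightarrow> (y, x) \<in> \<Theta>"
    and lattice_congruence_trans: "(x, y) \<in> \<Theta> \<Longrightarrow> (y, z) \<in> \<Theta> \<Longrightarrow> (x, z) \<in> \<Theta>"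
    and lattice_congruence_carrier: "(x, y) \<in> \<Theta> \<Longrightarrow> x \<in> carrier L \<and> y \<in> carrier L"
    and lattice_congruence_join:
      "(x, x') \<in> \<Theta> \<Longrightarrow> (y, y') \<in> \<Theta> \<Longrightarrow> (x \<squnion>\<^bsub>L\<^esub> y, x' \<squnion>\<^bsub>L\<^esub> y') \<in> \<Theta>"
    and lattice_congruence_meet:
      "(x, x') \<in> \<Theta> \<Longrightarrow> (y, y') \<in> \<Theta> \<Longrightarrow> (x \<sqinter>\<^bsub>L\<^esub> y, x' \<sqinter>\<^bsub>L\<^esub> y') \<in> \<Theta>"
  using assms unfolding lattice_congruence_def equiv_def refl_on_def sym_def
  by (blast dest: transD)+

lemma finite_minimal_in:
  assumes "finite A" "A \<noteq> {}" "antisym r" "trans r"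
  obtains x where "minimal_in r A x"
proof -
  have "asymp_on A (\<lambda>x y. (y, x) \<in> r \<and> x \<noteq> y)"
    using assms(3) by (auto intro!: asymp_onI dest: antisymD)
  moreover have "transp_on A (\<lambda>x y. (y, x) \<in> r \<and> x \<noteq> y)"
    using assms(3,4) by (auto intro!: transp_onI dest: antisymD transD)
  ultimately obtain m where "m \<in> A" "\<forall>y\<in>A. y \<noteq> m \<longrightarrow> \<not> ((m, y) \<in> r \<and> y \<noteq> m)"
    using Finite_Set.bex_min_element[OF assms(1) _ _ assms(2)] by blast
  then show ?thesis using that by (auto simp: minimal_in_def)
qed

lemma maximal_in_iff: "maximal_in r A x \<longleftrightarrow> minimal_in (r\<inverse>) A x"
  by (simp add: maximal_in_def minimal_in_def)

section \<open>Join-irreducible pairs\<close>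

locale finite_two_acyclic =
  fixes S :: "'a set" and arrow onto into :: "'a rel"
  assumes finite_S: "finite S"
    and two_acyclic: "two_acyclic_factorization_system S arrow onto into"
begin

abbreviation L where "L \<equiv> Pairs S arrow"
abbreviation T where "T \<equiv> T_set S onto"
abbreviation F where "F \<equiv> F_set S into"
abbreviation J where "J \<equiv> T_pair S arrow onto"

text \<open>The candidate for the lower cover of \<open>J x\<close>. That it is a pair at all
  depends on the brick condition, through \<open>meet_J_M\<close>.\<close>

definition J_low where "J_low x = (T x - {x}, right_perp S arrow (T x - {x}))"
definition M where "M x = (left_perp S arrow (F x), F x)"

section \<open>The arrow relation and its two factors\<close>

lemma onto_iff:
  "(x, y) \<in> onto \<longleftrightarrow> x \<in> S \<and> y \<in> S \<and> (\<forall>z\<in>S. (y, z) \<in> arrow \<longrightarrow> (x, z) \<in> arrow)"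
  and into_iff:
  "(x, y) \<in> into \<longleftrightarrow> x \<in> S \<and> y \<in> S \<and> (\<forall>z\<in>S. (z, x) \<in> arrow \<longrightarrow> (z, y) \<in> arrow)"
  using two_acyclic
  by (auto simp: two_acyclic_factorization_system_def factorization_system_def Fact_def)

lemma arrow_S: "(x, y) \<in> arrow \<Longrightarrow> x \<in> S \<and> y \<in> S"
  and arrow_refl: "x \<in> S \<Longrightarrow> (x, x) \<in> arrow"
  and order: "antisym onto" "antisym into"
  and brick: "(x, y) \<in> onto \<Longrightarrow> (y, x) \<in> into \<Longrightarrow> x = y"
  using two_acyclic
  by (auto simp: two_acyclic_factorization_system_def factorization_system_def
      order_condition_def brick_condition_def refl_on_def)

lemma onto_S: "(x, y) \<in> onto \<Longrightarrow> x \<in> S \<and> y \<in> S"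
  and into_S: "(x, y) \<in> into \<Longrightarrow> x \<in> S \<and> y \<in> S"
  and onto_refl: "x \<in> S \<Longrightarrow> (x, x) \<in> onto"
  and into_refl: "x \<in> S \<Longrightarrow> (x, x) \<in> into"
  and onto_trans: "trans onto" and into_trans: "trans into"
  by (auto simp: onto_iff into_iff intro!: transI)

lemma onto_arrow: "(x, y) \<in> onto \<Longrightarrow> (y, z) \<in> arrow \<Longrightarrow> (x, z) \<in> arrow"
  and arrow_into: "(x, y) \<in> arrow \<Longrightarrow> (y, z) \<in> into \<Longrightarrow> (x, z) \<in> arrow"
  using arrow_S by (auto simp: onto_iff into_iff)

lemma onto_imp_arrow: "(x, y) \<in> onto \<Longrightarrow> (x, y) \<in> arrow"
  and into_imp_arrow: "(x, y) \<in> into \<Longrightarrow> (x, y) \<in> arrow"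
  using onto_arrow arrow_into arrow_refl onto_S into_S by blast+

lemma arrow_factor:
  assumes "(x, z) \<in> arrow"
  obtains y where "(x, y) \<in> onto" "(y, z) \<in> into"
proof -
  have "(x, z) \<in> Mult S onto into"
    using assms two_acyclic
    by (simp add: two_acyclic_factorization_system_def factorization_system_def)
  then show ?thesis using that by (auto simp: Mult_def)
qed

text \<open>Factoring the arrow back to \<open>x\<close> gives x \<twoheadrightarrow> w
  \<twoheadrightarrow> v \<hookrightarrow> x. The brick condition yields v = x, and antisymmetry of
  \<open>onto\<close> finishes.\<close>

lemma onto_arrow_eq:
  assumes "(x, w) \<in> onto" "(w, x) \<in> arrow"
  shows "w = x"
proof -
  obtain v where v: "(w, v) \<in> onto" "(v, x) \<in> into" using assms(2) by (rule arrow_factor)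
  then have "x = v" using brick transD[OF onto_trans assms(1)] by blast
  then show ?thesis using v assms(1) order(1) by (auto dest: antisymD)
qed

lemma arrow_into_eq:
  assumes "(x, w) \<in> arrow" "(w, x) \<in> into"
  shows "w = x"
proof -
  obtain v where v: "(x, v) \<in> onto" "(v, w) \<in> into" using assms(1) by (rule arrow_factor)
  then have "x = v" using brick transD[OF into_trans _ assms(2)] by blast
  then show ?thesis using v assms(2) order(2) by (auto dest: antisymD)
qed

section \<open>The pairs attached to an element of \<open>S\<close>\<close>

lemma mem_T: "y \<in> T x \<longleftrightarrow> (x, y) \<in> onto"
  and mem_F: "y \<in> F x \<longleftrightarrow> (y, x) \<in> into"
  using onto_S into_S by (auto simp: T_set_def F_set_def)

lemma fst_J [simp]: "fst (J x) = T x"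
  and fst_J_low [simp]: "fst (J_low x) = T x - {x}"
  and snd_M [simp]: "snd (M x) = F x"
  by (simp_all add: T_pair_def J_low_def M_def)

text \<open>Any arrow out of an element of \<open>T x\<close> can be lifted to start at
  \<open>x\<close>, so only \<open>x\<close> itself has to be tested.\<close>

lemma snd_J: "x \<in> S \<Longrightarrow> snd (J x) = {z \<in> S. (x, z) \<notin> arrow}"
  using onto_refl onto_arrow by (auto simp: T_pair_def right_perp_def mem_T)

lemma fst_M: "x \<in> S \<Longrightarrow> fst (M x) = {w \<in> S. (w, x) \<notin> arrow}"
  using into_refl arrow_into by (auto simp: M_def left_perp_def mem_F)

text \<open>An element w lies in the double orthogonal of \<open>T x\<close> iff every arrow from w
  to some z gives an arrow from \<open>x\<close> to z; by \<open>Fact\<close> this says (x, w) \<in>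
  \<open>onto\<close>.\<close>

lemma J_carrier: "x \<in> S \<Longrightarrow> J x \<in> carrier L"
  unfolding carrier_Pairs_iff snd_J
  by (auto simp: T_set_def left_perp_def right_perp_def onto_iff)

lemma M_carrier: "x \<in> S \<Longrightarrow> M x \<in> carrier L"
  unfolding carrier_Pairs_iff fst_M
  by (auto simp: F_set_def left_perp_def right_perp_def into_iff)

text \<open>By \<open>onto_arrow_eq\<close>, the only element of \<open>T x\<close> with an arrow to
  \<open>x\<close> is \<open>x\<close>.\<close>

lemma meet_J_M:
  assumes "x \<in> S"
  shows "fst (J x) \<inter> fst (M x) = T x - {x}"
  using assms onto_arrow_eq arrow_refl by (auto simp: fst_M mem_T dest: onto_S)

lemma J_low_carrier:
  assumes "x \<in> S"
  shows "J_low x \<in> carrier L"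
proof -
  note c = J_carrier[OF assms] M_carrier[OF assms]
  have m: "J x \<sqinter>\<^bsub>L\<^esub> M x \<in> carrier L" using c by (rule meet_Pairs_closed)
  have fst: "fst (J x \<sqinter>\<^bsub>L\<^esub> M x) = T x - {x}"
    using fst_meet_Pairs[OF c] meet_J_M[OF assms] by (rule trans)
  have "snd (J x \<sqinter>\<^bsub>L\<^esub> M x) = right_perp S arrow (T x - {x})"
    using m unfolding carrier_Pairs_iff fst by (rule conjunct1)
  with fst have eq: "J x \<sqinter>\<^bsub>L\<^esub> M x = J_low x"
    by (simp add: J_low_def prod_eq_iff)
  show ?thesis using m unfolding eq .
qed

lemma Pairs_fst_down:
  assumes "p \<in> carrier L" "x \<in> fst p" "(x, y) \<in> onto"
  shows "y \<in> fst p"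
proof (rule Pairs_fstI[OF assms(1)])
  show "y \<in> S" using assms(3) onto_S by blast
  show "(y, z) \<notin> arrow" if "z \<in> snd p" for z
    using Pairs_disjoint[OF assms(1,2) that] onto_arrow[OF assms(3)] by blast
qed

lemma Pairs_snd_down:
  assumes "p \<in> carrier L" "x \<in> snd p" "(y, x) \<in> into"
  shows "y \<in> snd p"
proof (rule Pairs_sndI[OF assms(1)])
  show "y \<in> S" using assms(3) into_S by blast
  show "(z, y) \<notin> arrow" if "z \<in> fst p" for z
    using Pairs_disjoint[OF assms(1) that assms(2)] arrow_into[OF _ assms(3)] by blast
qed

lemma T_subset: "p \<in> carrier L \<Longrightarrow> x \<in> fst p \<Longrightarrow> T x \<subseteq> fst p"
  using Pairs_fst_down mem_T by blast

lemma covers_L: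
  "covers L p q \<longleftrightarrow> p \<in> carrier L \<and> q \<in> carrier L \<and> fst q \<subset> fst p \<and>
    \<not> (\<exists>r\<in>carrier L. fst q \<subset> fst r \<and> fst r \<subset> fst p)"
  using Pairs_eqI[of _ S arrow] unfolding covers_def lless_def le_Pairs eq_Pairs psubset_eq
  by (metis (no_types, lifting))

text \<open>A pair strictly below \<open>J x\<close> cannot have \<open>x\<close> in its first
  component, since it would then contain all of \<open>T x\<close>. So \<open>J_low x\<close> is the
  largest pair strictly below \<open>J x\<close>.\<close>

lemma covers_J:
  assumes x: "x \<in> S"
  shows "covers L (J x) q \<longleftrightarrow> q = J_low x"
proof -
  have *: "fst r \<subseteq> T x - {x}" if "r \<in> carrier L" "fst r \<subset> T x" for r
    using that T_subset[of r x] by blast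
  have xT: "x \<in> T x" using x onto_refl mem_T by blast
  show ?thesis
  proof
    assume c: "covers L (J x) q"
    then have q: "q \<in> carrier L" "fst q \<subseteq> T x - {x}" using * unfolding covers_L by auto
    have "T x - {x} \<subset> T x" using xT by blast
    then have "\<not> fst q \<subset> T x - {x}"
      using c J_low_carrier[OF x] unfolding covers_L by (metis fst_J fst_J_low)
    then have "fst q = T x - {x}" using q by blast
    then show "q = J_low x" using Pairs_eqI[OF q(1) J_low_carrier[OF x]] by simp
  next
    assume "q = J_low x"
    then show "covers L (J x) q"
      using J_low_carrier[OF x] J_carrier[OF x] xT * unfolding covers_L by auto
  qed
qed

lemma lower_cover_J: "x \<in> S \<Longrightarrow> lower_cover L (J x) = J_low x"
  unfolding lower_cover_def by (rule the_equality) (simp_all add: covers_J)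

lemma finite_L: "finite (carrier L)"
proof (rule finite_subset)
  show "carrier L \<subseteq> Pow S \<times> Pow S" by (auto simp: Pairs_def)
qed (use finite_S in auto)

text \<open>Take a maximal element of the finite half-open interval from \<open>q\<close> (included)
  to \<open>p\<close> (excluded).\<close>

lemma ex_cover_above:
  assumes "p \<in> carrier L" "q \<in> carrier L" "fst q \<subset> fst p"
  obtains r where "covers L p r" "fst q \<subseteq> fst r"
proof -
  define A where "A = {r \<in> carrier L. fst q \<subseteq> fst r \<and> fst r \<subset> fst p}"
  have "q \<in> A" using assms by (simp add: A_def)
  moreover have "finite A" using finite_L by (simp add: A_def)
  ultimately have "finite (fst ` A)" "fst ` A \<noteq> {}" by auto
  from finite_has_maximal[OF this] obtain X
    where X: "X \<in> fst ` A" "\<forall>Y\<in>fst ` A. X \<subseteq> Y \<longrightarrow> X = Y" by (rule bexE)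
  from X(1) obtain r where "r \<in> A" "X = fst r" by (rule imageE)
  then have r: "r \<in> carrier L" "fst q \<subseteq> fst r" "fst r \<subset> fst p"
    and max: "\<And>s. s \<in> A \<Longrightarrow> fst r \<subseteq> fst s \<Longrightarrow> fst r = fst s"
    using X(2) unfolding A_def by blast+
  have "\<not> (fst r \<subset> fst s \<and> fst s \<subset> fst p)" if "s \<in> carrier L" for s
    using max[of s] that r(2) unfolding A_def by blast
  then have "covers L p r" unfolding covers_L using r assms by simp
  then show ?thesis using that r by blast
qed

text \<open>For surjectivity, choose \<open>x\<close> in the first component of \<open>j\<close> but
  not in that of its only lower cover \<open>q\<close>. If \<open>J x\<close> were strictly below
  \<open>j\<close>, it would lie below a lower cover, hence below \<open>q\<close>, contrary to the
  choice of \<open>x\<close>.\<close>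

lemma J_bij: "bij_betw J S (Ji L)"
proof (rule bij_betw_imageI)
  show "inj_on J S"
    using order(1) onto_refl by (auto simp: inj_on_def T_pair_def set_eq_iff mem_T dest: antisymD)
  show "J ` S = Ji L"
  proof (intro equalityI subsetI)
    fix j assume "j \<in> J ` S"
    then obtain x where "x \<in> S" "j = J x" by blast
    then have "covers L j (J_low x)" "\<And>q. covers L j q \<Longrightarrow> q = J_low x" "j \<in> carrier L"
      using J_carrier by (simp_all add: covers_J)
    then show "j \<in> Ji L" unfolding Ji_def by blast
  next
    fix j assume "j \<in> Ji L"
    then obtain q where j: "j \<in> carrier L" and c: "covers L j q"
      and u: "\<And>r. covers L j r \<Longrightarrow> r = q" by (auto simp: Ji_def)
    obtain x where x: "x \<in> fst j" "x \<notin> fst q" using c unfolding covers_L by blast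
    have xS: "x \<in> S" using x j Pairs_subset by blast
    have "T x \<subseteq> fst j" using T_subset j x by blast
    moreover have "\<not> T x \<subset> fst j"
    proof
      assume "T x \<subset> fst j"
      then obtain r where "covers L j r" "T x \<subseteq> fst r"
        using ex_cover_above[of j "J x"] J_carrier[OF xS] j by auto
      then show False using u x onto_refl[OF xS] mem_T by blast
    qed
    ultimately have "J x = j" using Pairs_eqI[OF J_carrier[OF xS] j] by auto
    then show "j \<in> J ` S" using xS by blast
  qed
qed

section \<open>The elements contracted by a congruence\<close>

text \<open>On congruences this is the inverse of the map \<open>cong_of\<close> on
  downsets.\<close>

definition contracted where "contracted \<Theta> = {x \<in> S. contracts L \<Theta> (J x)}"

lemma contracted_iff: "x \<in> contracted \<Theta> \<longleftrightarrow> x \<in> S \<and> (J_low x, J x) \<in> \<Theta>"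
  by (auto simp: contracted_def contracts_def lower_cover_J)

text \<open>Meeting with \<open>J x\<close> and then joining with \<open>J_low x\<close> sends
  \<open>q\<close> to \<open>J x\<close>. It sends \<open>p\<close> to \<open>J_low x\<close>,
  because the meet of \<open>p\<close> and \<open>J x\<close> misses \<open>x\<close>.\<close>

lemma contractedI:
  assumes \<Theta>: "lattice_congruence L \<Theta>" and pq: "(p, q) \<in> \<Theta>" and x: "x \<in> S" "x \<notin> fst p" "x \<in> fst q"
  shows "x \<in> contracted \<Theta>"
proof -
  note J = J_carrier[OF x(1)] and Jl = J_low_carrier[OF x(1)]
  have p: "p \<in> carrier L" and q: "q \<in> carrier L"
    using lattice_congruence_carrier[OF \<Theta> pq] by auto
  have "(p \<sqinter>\<^bsub>L\<^esub> J x, q \<sqinter>\<^bsub>L\<^esub> J x) \<in> \<Theta>"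
    by (rule lattice_congruence_meet[OF \<Theta> pq lattice_congruence_refl[OF \<Theta> J]])
  moreover have "q \<sqinter>\<^bsub>L\<^esub> J x = J x"
    using T_subset[OF q x(3)] by (intro meet_Pairs_eqI q J) auto
  ultimately have "((p \<sqinter>\<^bsub>L\<^esub> J x) \<squnion>\<^bsub>L\<^esub> J_low x, J x \<squnion>\<^bsub>L\<^esub> J_low x) \<in> \<Theta>"
    using lattice_congruence_join[OF \<Theta> _ lattice_congruence_refl[OF \<Theta> Jl]] by simp
  moreover have "(p \<sqinter>\<^bsub>L\<^esub> J x) \<squnion>\<^bsub>L\<^esub> J_low x = J_low x"
    using x(2) by (intro join_Pairs_absorb meet_Pairs_closed p J Jl)
      (auto simp: fst_meet_Pairs[OF p J])
  moreover have "J x \<squnion>\<^bsub>L\<^esub> J_low x = J x"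
    using Pairs_snd_antimono[OF Jl J] by (intro join_Pairs_eqI J Jl) auto
  ultimately show ?thesis using x(1) by (simp add: contracted_iff)
qed

text \<open>Joining with \<open>M x\<close>, which lies above \<open>J_low x\<close>, carries the
  contraction at \<open>J x\<close> to the dual side.\<close>

lemma contracted_M:
  assumes \<Theta>: "lattice_congruence L \<Theta>" and x: "x \<in> contracted \<Theta>"
  shows "(M x, M x \<squnion>\<^bsub>L\<^esub> J x) \<in> \<Theta>"
proof -
  have xS: "x \<in> S" and c: "(J_low x, J x) \<in> \<Theta>" using x by (auto simp: contracted_iff)
  note J = J_carrier[OF xS] and Jl = J_low_carrier[OF xS] and M = M_carrier[OF xS]
  have "fst (J_low x) \<subseteq> fst (M x)" using meet_J_M[OF xS] by auto
  then have "M x \<squnion>\<^bsub>L\<^esub> J_low x = M x"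
    using Pairs_snd_antimono[OF Jl M] by (intro join_Pairs_eqI M Jl) auto
  then show ?thesis
    using lattice_congruence_join[OF \<Theta> lattice_congruence_refl[OF \<Theta> M] c] by simp
qed

text \<open>In each case two congruent pairs are found of which only the larger has \<open>y\<close>
  in its first component; \<open>contractedI\<close> then applies.\<close>

lemma contracted_squig_closed:
  assumes \<Theta>: "lattice_congruence L \<Theta>" and x: "x \<in> contracted \<Theta>"
    and xy: "(x, y) \<in> squig S onto into"
  shows "y \<in> contracted \<Theta>"
proof -
  have xS: "x \<in> S" and yS: "y \<in> S" using xy by (auto simp: squig_def)
  note J = J_carrier[OF xS] and Jl = J_low_carrier[OF xS]
    and Mx = M_carrier[OF xS] and My = M_carrier[OF yS]
  consider "minimal_in onto (F y) x" | "maximal_in into (T y) x"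
    using xy by (auto simp: squig_def)
  then show ?thesis
  proof cases
    case 1
    then have xy: "(x, y) \<in> into" and min: "\<And>v. (v, y) \<in> into \<Longrightarrow> (x, v) \<in> onto \<Longrightarrow> v = x"
      by (auto simp: minimal_in_def mem_F)
    have c: "(M y \<squnion>\<^bsub>L\<^esub> J_low x, M y \<squnion>\<^bsub>L\<^esub> J x) \<in> \<Theta>"
      using x lattice_congruence_join[OF \<Theta> lattice_congruence_refl[OF \<Theta> My]]
      by (simp add: contracted_iff)
    show ?thesis
    proof (rule contractedI[OF \<Theta> c yS])
      \<comment> \<open>An arrow from w in T x - {x} to \<open>y\<close> would factor through some v
        in \<open>F y\<close> below \<open>x\<close>. Minimality gives v = x, so \<open>w\<close>
        and \<open>x\<close> are \<open>onto\<close>-related both ways and hence equal.\<close>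
      have "y \<in> snd (J_low x)"
      proof (rule Pairs_sndI[OF Jl yS], rule notI)
        fix w assume w: "w \<in> fst (J_low x)" and "(w, y) \<in> arrow"
        then obtain v where v: "(w, v) \<in> onto" "(v, y) \<in> into" by (elim arrow_factor)
        have xw: "(x, w) \<in> onto" "w \<noteq> x" using w by (auto simp: mem_T)
        then have "v = x" using min v transD[OF onto_trans] by blast
        then show False using v xw order(1) by (auto dest: antisymD)
      qed
      then have "y \<in> snd (M y \<squnion>\<^bsub>L\<^esub> J_low x)"
        using into_refl[OF yS] by (simp add: snd_join_Pairs[OF My Jl] mem_F)
      then show "y \<notin> fst (M y \<squnion>\<^bsub>L\<^esub> J_low x)"
        using Pairs_disjoint[OF join_Pairs_closed[OF My Jl]] arrow_refl[OF yS] by blast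
      show "y \<in> fst (M y \<squnion>\<^bsub>L\<^esub> J x)"
      proof (rule Pairs_fstI[OF join_Pairs_closed[OF My J] yS], rule notI)
        fix z assume "z \<in> snd (M y \<squnion>\<^bsub>L\<^esub> J x)" and yz: "(y, z) \<in> arrow"
        then have z: "(z, y) \<in> into" "(x, z) \<notin> arrow"
          by (auto simp: snd_join_Pairs[OF My J] snd_J[OF xS] mem_F)
        \<comment> \<open>So \<open>y\<close> would itself be orthogonal to \<open>x\<close>,
          although x \<hookrightarrow> y.\<close>
        then have "z = y" using arrow_into_eq yz by blast
        then show False using z into_imp_arrow[OF xy] by simp
      qed
    qed
  next
    case 2
    then have yx: "(y, x) \<in> onto" and max: "\<And>v. (y, v) \<in> onto \<Longrightarrow> (v, x) \<in> into \<Longrightarrow> v = x"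
      by (auto simp: maximal_in_def mem_T)
    show ?thesis
    proof (rule contractedI[OF \<Theta> contracted_M[OF \<Theta> x] yS])
      show "y \<notin> fst (M x)" using onto_imp_arrow[OF yx] by (simp add: fst_M[OF xS])
      show "y \<in> fst (M x \<squnion>\<^bsub>L\<^esub> J x)"
      proof (rule Pairs_fstI[OF join_Pairs_closed[OF Mx J] yS], rule notI)
        fix z assume "z \<in> snd (M x \<squnion>\<^bsub>L\<^esub> J x)" and yz: "(y, z) \<in> arrow"
        then have z: "(z, x) \<in> into" "(x, z) \<notin> arrow"
          by (auto simp: snd_join_Pairs[OF Mx J] snd_J[OF xS] mem_F)
        obtain v where v: "(y, v) \<in> onto" "(v, z) \<in> into" using yz by (rule arrow_factor)
        \<comment> \<open>Here v \<hookrightarrow> z \<hookrightarrow> x, so maximality of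
          \<open>x\<close> in \<open>T y\<close> applies; then x \<hookrightarrow> z contradicts the
          missing arrow from \<open>x\<close> to \<open>z\<close>.\<close>
        then have "v = x" using max z transD[OF into_trans] by blast
        then show False using v z into_imp_arrow by blast
      qed
    qed
  qed
qed

lemma contracted_downset:
  assumes "lattice_congruence L \<Theta>"
  shows "contracted \<Theta> \<in> carrier (squig_downsets S onto into)"
proof -
  have "contracted \<Theta> \<subseteq> S" by (simp add: contracted_def)
  then show ?thesis
    using contracted_squig_closed[OF assms] by (simp add: squig_downsets_def) blast
qed

lemma congruent_upI:
  assumes \<Theta>: "lattice_congruence L \<Theta>" and q: "q \<in> carrier L"
  shows "p \<in> carrier L \<Longrightarrow> fst p \<subseteq> fst q \<Longrightarrow> fst q - fst p \<subseteq> contracted \<Theta> \<Longrightarrow> (p, q) \<in> \<Theta>"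
proof (induction "card (fst q - fst p)" arbitrary: p rule: less_induct)
  case less
  have fin: "finite (fst q - fst p)"
    using Pairs_subset[OF q] finite_S by (meson finite_Diff finite_subset)
  show ?case
  proof (cases "fst q = fst p")
    case True
    then show ?thesis using less.prems q Pairs_eqI lattice_congruence_refl[OF \<Theta>] by metis
  next
    case False
    \<comment> \<open>Minimality places T y - {y} inside the first component of \<open>p\<close>.
      Hence \<open>J_low y\<close> lies below \<open>p\<close>, and joining its contraction with
      \<open>p\<close> makes \<open>p\<close> congruent to a strictly larger pair still below
      \<open>q\<close>.\<close>
    then obtain y where y: "minimal_in onto (fst q - fst p) y"
      using fin less.prems finite_minimal_in[OF _ _ order(1) onto_trans] by blast
    then have yq: "y \<in> fst q" and yp: "y \<notin> fst p" and "y \<in> contracted \<Theta>"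
      using less.prems by (auto simp: minimal_in_def)
    then have yS: "y \<in> S" and c: "(J_low y, J y) \<in> \<Theta>" by (auto simp: contracted_iff)
    note p = \<open>p \<in> carrier L\<close> and J = J_carrier[OF yS] and Jl = J_low_carrier[OF yS]
    let ?r = "J y \<squnion>\<^bsub>L\<^esub> p"
    have r: "?r \<in> carrier L" using J p by (rule join_Pairs_closed)
    have "T y - {y} \<subseteq> fst p"
      using y T_subset[OF q yq] by (auto simp: minimal_in_def mem_T)
    then have "J_low y \<squnion>\<^bsub>L\<^esub> p = p" using Jl p by (intro join_Pairs_absorb) auto
    then have pr: "(p, ?r) \<in> \<Theta>"
      using lattice_congruence_join[OF \<Theta> c lattice_congruence_refl[OF \<Theta> p]] by simp
    have "snd q \<subseteq> snd p" "snd q \<subseteq> snd (J y)"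
      using Pairs_snd_antimono[OF p q] Pairs_snd_antimono[OF J q] less.prems(2) T_subset[OF q yq]
      by simp_all
    then have rq: "fst ?r \<subseteq> fst q"
      using Pairs_snd_antimono[OF r q] snd_join_Pairs[OF J p] by simp
    have "snd ?r \<subseteq> snd p" "snd ?r \<subseteq> snd (J y)" using snd_join_Pairs[OF J p] by auto
    then have pr': "fst p \<subseteq> fst ?r" and "T y \<subseteq> fst ?r"
      using Pairs_snd_antimono[OF p r] Pairs_snd_antimono[OF J r] by auto
    then have "y \<in> fst ?r" using onto_refl[OF yS] mem_T by blast
    then have "card (fst q - fst ?r) < card (fst q - fst p)"
      using pr' yq yp fin by (intro psubset_card_mono) auto
    then have "(?r, q) \<in> \<Theta>" using less.hyps r rq pr' less.prems by blast
    then show ?thesis using lattice_congruence_trans[OF \<Theta> pr] by blast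
  qed
qed

section \<open>The congruence of a downset\<close>

definition cong_of where
  "cong_of D = {(p, q) \<in> carrier L \<times> carrier L. fst p - D = fst q - D}"

text \<open>By \<open>contractedI\<close>, congruent pairs differ only in contracted elements.
  Conversely, both pairs are reached from their meet by \<open>congruent_upI\<close>.\<close>

lemma cong_of_contracted:
  assumes \<Theta>: "lattice_congruence L \<Theta>"
  shows "cong_of (contracted \<Theta>) = \<Theta>"
proof (intro equalityI subrelI)
  fix p q assume pq: "(p, q) \<in> \<Theta>"
  have c: "p \<in> carrier L" "q \<in> carrier L" using lattice_congruence_carrier[OF \<Theta> pq] by auto
  have "fst q - fst p \<subseteq> contracted \<Theta>"
    using contractedI[OF \<Theta> pq] Pairs_subset(1)[OF c(2)] by blast
  moreover have "fst p - fst q \<subseteq> contracted \<Theta>"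
    using contractedI[OF \<Theta> lattice_congruence_sym[OF \<Theta> pq]] Pairs_subset(1)[OF c(1)] by blast
  ultimately show "(p, q) \<in> cong_of (contracted \<Theta>)" using c by (auto simp: cong_of_def)
next
  fix p q assume "(p, q) \<in> cong_of (contracted \<Theta>)"
  then have p: "p \<in> carrier L" and q: "q \<in> carrier L"
    and *: "fst p - contracted \<Theta> = fst q - contracted \<Theta>" by (auto simp: cong_of_def)
  let ?m = "p \<sqinter>\<^bsub>L\<^esub> q"
  have m: "?m \<in> carrier L" and fm: "fst ?m = fst p \<inter> fst q"
    using meet_Pairs_closed[OF p q] fst_meet_Pairs[OF p q] by simp_all
  have "fst p - fst ?m \<subseteq> contracted \<Theta>" "fst q - fst ?m \<subseteq> contracted \<Theta>"
    unfolding fm using * by blast+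
  then have "(?m, p) \<in> \<Theta>" "(?m, q) \<in> \<Theta>"
    using congruent_upI[OF \<Theta> p m] congruent_upI[OF \<Theta> q m] unfolding fm by simp_all
  then show "(p, q) \<in> \<Theta>"
    using lattice_congruence_sym[OF \<Theta>] lattice_congruence_trans[OF \<Theta>] by blast
qed

lemma snd_diff_subset:
  assumes D: "D \<in> carrier (squig_downsets S onto into)"
    and p: "p \<in> carrier L" and q: "q \<in> carrier L" and pq: "fst p - D = fst q - D"
  shows "snd p - D \<subseteq> snd q - D"
proof
  fix z assume z: "z \<in> snd p - D"
  then have zS: "z \<in> S" using Pairs_subset p by blast
  have "z \<in> snd q"
  proof (rule Pairs_sndI[OF q zS], rule notI)
    fix w assume w: "w \<in> fst q" and "(w, z) \<in> arrow"
    then obtain v where "(w, v) \<in> onto" "(v, z) \<in> into" by (elim arrow_factor)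
    then have "fst q \<inter> F z \<noteq> {}" using Pairs_fst_down[OF q w] mem_F by blast
    moreover have "finite (fst q \<inter> F z)"
      using finite_S Pairs_subset[OF q] by (meson finite_Int finite_subset)
    ultimately obtain v where v: "minimal_in onto (fst q \<inter> F z) v"
      using finite_minimal_in[OF _ _ order(1) onto_trans] by blast
    then have vq: "v \<in> fst q" and vz: "(v, z) \<in> into" by (auto simp: minimal_in_def mem_F)
    \<comment> \<open>First components are closed downward under \<open>onto\<close>, so an element
      of \<open>F z\<close> below \<open>v\<close> already lies in the first component of
      \<open>q\<close>.\<close>
    have "minimal_in onto (F z) v"
      using v Pairs_fst_down[OF q vq] by (auto simp: minimal_in_def)
    then have "(v, z) \<in> squig S onto into" using vz into_S by (auto simp: squig_def)
    then have "v \<notin> D" using z D by (auto simp: squig_downsets_def)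
    then have "v \<in> fst p" using vq pq by blast
    then show False using Pairs_disjoint[OF p] z into_imp_arrow[OF vz] by blast
  qed
  then show "z \<in> snd q - D" using z by blast
qed

text \<open>Dual to \<open>snd_diff_subset\<close>: a maximal element of \<open>T z\<close> in the
  second component supplies the other clause of \<open>squig\<close>.\<close>

lemma fst_diff_subset:
  assumes D: "D \<in> carrier (squig_downsets S onto into)"
    and p: "p \<in> carrier L" and q: "q \<in> carrier L" and pq: "snd p - D = snd q - D"
  shows "fst p - D \<subseteq> fst q - D"
proof
  fix z assume z: "z \<in> fst p - D"
  then have zS: "z \<in> S" using Pairs_subset p by blast
  have "z \<in> fst q"
  proof (rule Pairs_fstI[OF q zS], rule notI)
    fix w assume w: "w \<in> snd q" and "(z, w) \<in> arrow"
    then obtain v where "(z, v) \<in> onto" "(v, w) \<in> into" by (elim arrow_factor)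
    then have "snd q \<inter> T z \<noteq> {}" using Pairs_snd_down[OF q w] mem_T by blast
    moreover have "finite (snd q \<inter> T z)"
      using finite_S Pairs_subset[OF q] by (meson finite_Int finite_subset)
    moreover have "antisym (into\<inverse>)" "trans (into\<inverse>)" using order(2) into_trans by simp_all
    ultimately obtain v where v: "maximal_in into (snd q \<inter> T z) v"
      unfolding maximal_in_iff by (metis finite_minimal_in)
    then have vq: "v \<in> snd q" and vz: "(z, v) \<in> onto" by (auto simp: maximal_in_def mem_T)
    have "maximal_in into (T z) v"
      using v Pairs_snd_down[OF q vq] by (auto simp: maximal_in_def)
    then have "(v, z) \<in> squig S onto into" using vz onto_S by (auto simp: squig_def)
    then have "v \<notin> D" using z D by (auto simp: squig_downsets_def)
    then have "v \<in> snd p" using vq pq by blast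
    then show False using Pairs_disjoint[OF p] z onto_imp_arrow[OF vz] by blast
  qed
  then show "z \<in> fst q - D" using z by blast
qed

lemma cong_of_iff_snd:
  assumes "D \<in> carrier (squig_downsets S onto into)" "p \<in> carrier L" "q \<in> carrier L"
  shows "(p, q) \<in> cong_of D \<longleftrightarrow> snd p - D = snd q - D"
proof -
  have "fst p - D = fst q - D \<longleftrightarrow> snd p - D = snd q - D"
    using fst_diff_subset[OF assms(1)] snd_diff_subset[OF assms(1)] assms(2,3)
    by (metis subset_antisym)
  then show ?thesis using assms(2,3) by (simp add: cong_of_def)
qed

text \<open>Joins are compatible when agreement is read on second components, meets when it is read
  on first components.\<close>

lemma lattice_congruence_cong_of:
  assumes D: "D \<in> carrier (squig_downsets S onto into)"
  shows "lattice_congruence L (cong_of D)"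
  unfolding lattice_congruence_def
proof (intro conjI allI impI)
  show "equiv (carrier L) (cong_of D)"
    by (rule equivI) (auto simp: cong_of_def refl_on_def sym_def trans_def)
next
  fix p p' q q' assume *: "(p, p') \<in> cong_of D \<and> (q, q') \<in> cong_of D"
  then have c: "p \<in> carrier L" "p' \<in> carrier L" "q \<in> carrier L" "q' \<in> carrier L"
    by (auto simp: cong_of_def)
  have "snd p - D = snd p' - D" "snd q - D = snd q' - D"
    using * cong_of_iff_snd[OF D] c by auto
  then have "snd p \<inter> snd q - D = snd p' \<inter> snd q' - D" by blast
  then show "(p \<squnion>\<^bsub>L\<^esub> q, p' \<squnion>\<^bsub>L\<^esub> q') \<in> cong_of D"
    using c by (simp add: cong_of_iff_snd[OF D] join_Pairs_closed snd_join_Pairs)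
  have "fst p - D = fst p' - D" "fst q - D = fst q' - D"
    using * by (auto simp: cong_of_def)
  then have "fst p \<inter> fst q - D = fst p' \<inter> fst q' - D" by blast
  then show "(p \<sqinter>\<^bsub>L\<^esub> q, p' \<sqinter>\<^bsub>L\<^esub> q') \<in> cong_of D"
    using c by (simp add: cong_of_def meet_Pairs_closed fst_meet_Pairs)
qed

text \<open>The first components of \<open>J_low x\<close> and \<open>J x\<close> differ exactly in
  \<open>x\<close>, so they agree outside \<open>D\<close> iff \<open>x\<close> lies in
  \<open>D\<close>.\<close>

lemma contracted_cong_of:
  assumes "D \<in> carrier (squig_downsets S onto into)"
  shows "contracted (cong_of D) = D"
proof -
  have "D \<subseteq> S" using assms by (simp add: squig_downsets_def)
  moreover have "x \<in> contracted (cong_of D) \<longleftrightarrow> x \<in> D" if x: "x \<in> S" for x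
  proof -
    have "x \<in> T x" using onto_refl[OF x] by (simp add: mem_T)
    then have "T x - {x} - D = T x - D \<longleftrightarrow> x \<in> D" by blast
    then show ?thesis
      using x J_carrier[OF x] J_low_carrier[OF x] by (simp add: contracted_iff cong_of_def)
  qed
  ultimately show ?thesis by (auto simp: contracted_iff)
qed

section \<open>The isomorphism with the congruence lattice\<close>

lemma is_induced_congruence_iff:
  assumes "D \<in> carrier (squig_downsets S onto into)"
  shows "is_induced_congruence S arrow onto D \<Theta> \<longleftrightarrow> \<Theta> = cong_of D"
  using assms lattice_congruence_cong_of contracted_cong_of cong_of_contracted
  unfolding is_induced_congruence_def contracted_def[symmetric] Con_def by auto

lemma induced_congruence_eq:
  "D \<in> carrier (squig_downsets S onto into) \<Longrightarrow> induced_congruence S arrow onto D = cong_of D"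
  by (simp add: induced_congruence_def is_induced_congruence_iff)

text \<open>Both \<open>cong_of\<close> and its inverse \<open>contracted\<close> are
  monotone.\<close>

lemma cong_of_mono_iff:
  assumes "D \<in> carrier (squig_downsets S onto into)" "D' \<in> carrier (squig_downsets S onto into)"
  shows "cong_of D \<subseteq> cong_of D' \<longleftrightarrow> D \<subseteq> D'"
proof
  assume "cong_of D \<subseteq> cong_of D'"
  then have "contracted (cong_of D) \<subseteq> contracted (cong_of D')" by (auto simp: contracted_iff)
  then show "D \<subseteq> D'" using assms by (simp add: contracted_cong_of)
next
  assume "D \<subseteq> D'"
  then show "cong_of D \<subseteq> cong_of D'" unfolding cong_of_def by auto
qed

lemma poset_iso_induced_congruence:
  "poset_iso (squig_downsets S onto into) (Con L) (induced_congruence S arrow onto)"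
  unfolding poset_iso_def relation_iso_def
proof (intro conjI ballI)
  have "bij_betw cong_of (carrier (squig_downsets S onto into)) (carrier (Con L))"
    by (rule bij_betw_byWitness[where f' = contracted])
      (auto simp: contracted_cong_of cong_of_contracted contracted_downset
        lattice_congruence_cong_of Con_def)
  then show "bij_betw (induced_congruence S arrow onto)
      (carrier (squig_downsets S onto into)) (carrier (Con L))"
    by (simp add: induced_congruence_eq cong: bij_betw_cong)
next
  fix D D'
  assume "D \<in> carrier (squig_downsets S onto into)" "D' \<in> carrier (squig_downsets S onto into)"
  then have "induced_congruence S arrow onto D \<subseteq> induced_congruence S arrow onto D' \<longleftrightarrow> D \<subseteq> D'"
    by (simp add: induced_congruence_eq cong_of_mono_iff)
  then show "D \<sqsubseteq>\<^bsub>squig_downsets S onto into\<^esub> D' \<longleftrightarrow>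
      induced_congruence S arrow onto D \<sqsubseteq>\<^bsub>Con L\<^esub> induced_congruence S arrow onto D'"
    by (simp add: squig_downsets_def Con_def)
qed

section \<open>The forcing preorder\<close>

lemma squig_refl: "x \<in> S \<Longrightarrow> (x, x) \<in> squig S onto into"
  using into_refl by (auto simp: squig_def minimal_in_def mem_F dest: brick)

text \<open>Contracted sets are downsets, which gives forcing along \<open>squig\<close> paths. For
  the converse, forcing is tested on one congruence, that of the principal downset of
  \<open>x\<close>.\<close>

lemma forces_iff_squig:
  assumes x: "x \<in> S" and y: "y \<in> S"
  shows "forces L (J x) (J y) \<longleftrightarrow> (x, y) \<in> (squig S onto into)\<^sup>+"
proof
  assume *: "(x, y) \<in> (squig S onto into)\<^sup>+"
  have "y \<in> contracted \<Theta>" if "lattice_congruence L \<Theta>" "x \<in> contracted \<Theta>" for \<Theta>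
    using * that(2) by (induction rule: trancl_induct) (auto intro: contracted_squig_closed that(1))
  then show "forces L (J x) (J y)"
    using x by (auto simp: forces_def Con_def contracted_def)
next
  assume *: "forces L (J x) (J y)"
  \<comment> \<open>The least downset containing \<open>x\<close>; reflexivity of
    \<open>squig\<close> puts \<open>x\<close> into it even though the closure is only
    transitive.\<close>
  let ?D = "{z \<in> S. (x, z) \<in> (squig S onto into)\<^sup>+}"
  have D: "?D \<in> carrier (squig_downsets S onto into)"
    by (auto simp: squig_downsets_def squig_def intro: trancl_into_trancl)
  have "x \<in> contracted (cong_of ?D)"
    using x squig_refl[OF x] by (auto simp: contracted_cong_of[OF D])
  then have "y \<in> contracted (cong_of ?D)"
    using * y lattice_congruence_cong_of[OF D] by (auto simp: forces_def Con_def contracted_def)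
  then show "(x, y) \<in> (squig S onto into)\<^sup>+" by (simp add: contracted_cong_of[OF D])
qed

end

theorem corollary1p6:
  fixes S :: "'a set" and arrow onto into :: "'a rel"
  assumes "finite S"
    and "two_acyclic_factorization_system S arrow onto into"
  shows "relation_iso S (\<lambda>x y. (x, y) \<in> (squig S onto into)\<^sup>+)
           (Ji (Pairs S arrow)) (forces (Pairs S arrow))
           (T_pair S arrow onto) \<and>
         (\<forall>D \<in> carrier (squig_downsets S onto into).
           \<exists>!\<Theta>. is_induced_congruence S arrow onto D \<Theta>) \<and>
         poset_iso (squig_downsets S onto into) (Con (Pairs S arrow))
           (induced_congruence S arrow onto)"
proof -
  interpret finite_two_acyclic S arrow onto into using assms by unfold_locales
  show ?thesis
    using J_bij forces_iff_squig poset_iso_induced_congruence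
    by (auto simp: relation_iso_def is_induced_congruence_iff)
qed

end
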